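(* Let $S$ be a Steiner triple system of order $n>7$ and let $\Gamma_S$ be its block graph. If $n\equiv 1\pmod 4$ then $m(1,\Gamma_S)\le 4$, and if $n\equiv 3\pmod 4$ then $m(1,\Gamma_S)\le 5$.
   Context: A Steiner triple system (STS) of order $n$ is a collection $S$ of $3$-subsets (blocks) of $\{1,\dots,n\}$ such that every $2$-subset lies in exactly one block. The block graph $\Gamma_S$ has the blocks of $S$ as vertices, two distinct blocks being adjacent iff they intersect; it is strongly regular with eigenvalues $\theta_0>\theta_1>\theta_2$, where $\theta_1(\Gamma_S)=\frac{n-1}{2}-4$ and $\theta_2(\Gamma_S)=-3$. A $\theta$-eigenvector is a nonzero vector $v$ with $Av=\theta v$ for the adjacency matrix $A$. A vector is nowhere-zero integer (NZI) if all entries are nonzero integers; $\|v\|_\infty=\max_x|v_x|$. For a graph $\Gamma$, $m(i,\Gamma)=\min\{\|u\|_\infty+1: u \text{ an NZI } \theta_i(\Gamma)\text{-eigenvector of }\Gamma\}$. *)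

theory Defs
  imports Complex_Main "HOL-Library.Extended_Real"
begin

definition steiner_triple_system :: "nat \<Rightarrow> nat set set \<Rightarrow> bool" where
  "steiner_triple_system n S \<longleftrightarrow>
     (\<forall>B\<in>S. B \<subseteq> {1..n} \<and> card B = 3) \<and>
     (\<forall>P. P \<subseteq> {1..n} \<and> card P = 2 \<longrightarrow> (\<exists>!B. B \<in> S \<and> P \<subseteq> B))"

text \<open>A graph is a pair of its vertex set and its set of (two-element) edges.\<close>

type_synonym 'a graph = "'a set \<times> 'a set set"

abbreviation verts :: "'a graph \<Rightarrow> 'a set" where
  "verts \<equiv> fst"

abbreviation edges :: "'a graph \<Rightarrow> 'a set set" where
  "edges \<equiv> snd"

definition block_graph :: "'a set set \<Rightarrow> 'a set graph" where
  "block_graph S = (S, {{B, C} | B C. B \<in> S \<and> C \<in> S \<and> B \<noteq> C \<and> B \<inter> C \<noteq> {}})"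

definition adj_matrix :: "'a graph \<Rightarrow> 'a \<Rightarrow> 'a \<Rightarrow> real" where
  "adj_matrix G x y = (if {x, y} \<in> edges G then 1 else 0)"

text \<open>
  Vectors indexed by the vertices are functions of which only the values on the vertex set
  matter. All graphs considered are finite, and as the adjacency matrix is real and symmetric,
  real eigenvalues and eigenvectors suffice.
\<close>

definition is_eigenvector :: "'a graph \<Rightarrow> real \<Rightarrow> ('a \<Rightarrow> real) \<Rightarrow> bool" where
  "is_eigenvector G \<theta> v \<longleftrightarrow>
     (\<exists>x\<in>verts G. v x \<noteq> 0) \<and>
     (\<forall>x\<in>verts G. (\<Sum>y\<in>verts G. adj_matrix G x y * v y) = \<theta> * v x)"

definition eigenvalues :: "'a graph \<Rightarrow> real set" where
  "eigenvalues G = {\<theta>. \<exists>v. is_eigenvector G \<theta> v}"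

text \<open>
  The distinct eigenvalues in decreasing order, counted from 0. This is unspecified
  if there are at most \<open>i\<close> distinct eigenvalues.
\<close>

definition theta :: "nat \<Rightarrow> 'a graph \<Rightarrow> real" where
  "theta i G = rev (sorted_list_of_set (eigenvalues G)) ! i"

definition nowhere_zero_integer :: "'a graph \<Rightarrow> ('a \<Rightarrow> real) \<Rightarrow> bool" where
  "nowhere_zero_integer G u \<longleftrightarrow> (\<forall>x\<in>verts G. u x \<in> \<int> \<and> u x \<noteq> 0)"

definition sup_norm :: "'a graph \<Rightarrow> ('a \<Rightarrow> real) \<Rightarrow> real" where
  "sup_norm G u = Max ((\<lambda>x. \<bar>u x\<bar>) ` verts G)"

text \<open>
  On a finite graph the infimum ranges over positive integers, so it is a minimum whenever a
  nowhere-zero integer eigenvector exists. Otherwise it is \<open>\<infinity>\<close>, so that a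
  finite upper bound entails existence.
\<close>

definition m :: "nat \<Rightarrow> 'a graph \<Rightarrow> ereal" where
  "m i G = (INF u \<in> {u. nowhere_zero_integer G u \<and> is_eigenvector G (theta i G) u}.
              ereal (sup_norm G u + 1))"

end

theory Submission
  imports Defs
begin

text \<open>
  Point weights \<open>w\<close> with total \<open>0\<close> yield eigenvectors \<open>B \<mapsto> \<Sum>p\<in>B. w p\<close> for
  \<open>(n - 9) / 2\<close>, so it suffices to choose weights whose block sums are small and nonzero.

  If \<open>n \<equiv> 1 (mod 4)\<close>, a point \<open>p\<close> lies in an even number of blocks: put weight \<open>0\<close> on \<open>p\<close>,
  \<open>1\<close> on the other points of half of the blocks through \<open>p\<close>, and \<open>-1\<close> on the remaining points.
  Blocks through \<open>p\<close> then have sum \<open>\<plusminus>2\<close>, all others an odd sum.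

  For \<open>n \<equiv> 3 (mod 4)\<close>, take a block \<open>{p, q, r}\<close> with weights \<open>2, -3, -1\<close>. The blocks through \<open>p\<close>
  and those through \<open>q\<close> induce two perfect matchings on the remaining points, whose union is
  bipartite. Assign \<open>\<plusminus>1\<close> according to a bipartition and then change one \<open>-1\<close> into \<open>1\<close>.
\<close>

section \<open>Proper 2-colouring of a union of two perfect matchings\<close>

text \<open>Induction on \<open>X\<close>: remove an \<open>f\<close>-pair \<open>a\<close>,
  \<open>b\<close> and match the stranded partners \<open>g a\<close> and \<open>g b\<close> with
  each other. A colouring of the rest gives these partners opposite colours, which leaves room for
  opposite colours on \<open>a\<close> and \<open>b\<close>.\<close>

lemma two_matchings_colouring:
  assumes "finite X"
    and "\<And>x. x \<in> X \<Longrightarrow> f x \<in> X \<and> f x \<noteq> x \<and> f (f x) = x"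
    and "\<And>x. x \<in> X \<Longrightarrow> g x \<in> X \<and> g x \<noteq> x \<and> g (g x) = x"
  shows "\<exists>c :: 'a \<Rightarrow> bool. \<forall>x\<in>X. c (f x) \<noteq> c x \<and> c (g x) \<noteq> c x"
  using assms
proof (induction X arbitrary: g rule: finite_psubset_induct)
  case (psubset X)
  note f = psubset.prems(1) and g = psubset.prems(2)
  show ?case
  proof (cases "X = {}")
    case False
    then obtain a where a: "a \<in> X" by blast
    define b where "b = f a"
    have b: "b \<in> X" "b \<noteq> a" "f b = a" using f[OF a] by (auto simp: b_def)
    define Y where "Y = X - {a, b}"
    \<comment> \<open>If \<open>g a = b\<close>, the first two cases concern only \<open>a\<close>
      and \<open>b\<close> themselves, so \<open>g'\<close> agrees with \<open>g\<close> on
      \<open>Y\<close>.\<close>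
    define g' where "g' y = (if y = g a then g b else if y = g b then g a else g y)" for y
    have fY: "f y \<in> Y \<and> f y \<noteq> y \<and> f (f y) = y" if "y \<in> Y" for y
    proof -
      have "f y \<noteq> b" "f y \<noteq> a" using f[of y] that b by (auto simp: Y_def b_def)
      then show ?thesis using f[of y] that by (auto simp: Y_def)
    qed
    have g'Y: "g' y \<in> Y \<and> g' y \<noteq> y \<and> g' (g' y) = y" if "y \<in> Y" for y
    proof -
      have gab: "g a \<noteq> g b" using g[OF a] g[OF b(1)] b(2) by metis
      consider "y = g a" | "y = g b" | "y \<noteq> g a" "y \<noteq> g b" by blast
      then show ?thesis
      proof cases
        case 1
        then show ?thesis using that gab g[OF a] g[OF b(1)] by (auto simp: Y_def g'_def)
      next
        case 2
        then show ?thesis using that gab g[OF a] g[OF b(1)] by (auto simp: Y_def g'_def)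
      next
        case 3
        have y: "y \<in> X" "y \<noteq> a" "y \<noteq> b" using that by (auto simp: Y_def)
        have "g y \<noteq> a" "g y \<noteq> b" using g[OF y(1)] 3 by auto
        moreover have "g y \<noteq> g a" "g y \<noteq> g b"
          using g[OF y(1)] g[OF a] g[OF b(1)] y by metis+
        ultimately show ?thesis using 3 g[OF y(1)] by (simp add: Y_def g'_def)
      qed
    qed
    have "Y \<subset> X" using a by (auto simp: Y_def)
    then have "\<exists>c :: 'a \<Rightarrow> bool. \<forall>y\<in>Y. c (f y) \<noteq> c y \<and> c (g' y) \<noteq> c y"
      by (rule psubset.IH) (fact fY g'Y)+
    then obtain c :: "'a \<Rightarrow> bool"
      where c: "\<And>y. y \<in> Y \<Longrightarrow> c (f y) \<noteq> c y \<and> c (g' y) \<noteq> c y" by blast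
    \<comment> \<open>If \<open>g a \<noteq> b\<close>, then \<open>c (g b)\<close> is the negation
      of \<open>c (g a)\<close>, so \<open>b\<close> differs from \<open>g b\<close>. If
      \<open>g a = b\<close>, any opposite colours on \<open>a\<close> and \<open>b\<close> will
      do.\<close>
    define d where "d = c(a := \<not> c (g a), b := c (g a))"
    have "d (f x) \<noteq> d x \<and> d (g x) \<noteq> d x" if x: "x \<in> X" for x
    proof -
      consider "x = a" | "x = b" | "x \<in> Y" using x by (auto simp: Y_def)
      then show ?thesis
      proof cases
        case 1
        then show ?thesis using g[OF a] b(2) by (auto simp: d_def b_def[symmetric])
      next
        case 2
        have "c (g b) \<noteq> c (g a)" if "g b \<noteq> a"
        proof -
          have "g a \<in> Y" using g[OF a] g[OF b(1)] that by (auto simp: Y_def)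
          from c[OF this] show ?thesis by (simp add: g'_def)
        qed
        then show ?thesis using 2 g[OF b(1)] b by (auto simp: d_def)
      next
        case 3
        have "f x \<in> Y" using fY[OF 3] by blast
        then have "d (f x) \<noteq> d x" using c[OF 3] 3 by (auto simp: d_def Y_def)
        moreover have "d (g x) \<noteq> d x"
        proof -
          consider "g x = a" | "g x = b" | "g x \<in> Y" using g[OF x] by (auto simp: Y_def)
          then show ?thesis
          proof cases
            case 1
            then have "g a = x" using g[OF x] by blast
            then show ?thesis using 1 3 b(2) by (auto simp: d_def Y_def)
          next
            case 2
            then have gb: "g b = x" using g[OF x] by blast
            have "x \<noteq> g a" using gb g[OF a] g[OF b(1)] b(2) by metis
            then have "g' x = g a" by (simp add: g'_def gb)
            then show ?thesis using 2 3 c[OF 3] by (auto simp: d_def Y_def)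
          next
            case 3
            then have "x \<noteq> g a" "x \<noteq> g b" using g[OF a] g[OF b(1)] by (auto simp: Y_def)
            then have "g' x = g x" by (simp add: g'_def)
            then show ?thesis using 3 \<open>x \<in> Y\<close> c[OF \<open>x \<in> Y\<close>] by (auto simp: d_def Y_def)
          qed
        qed
        ultimately show ?thesis by blast
      qed
    qed
    then show ?thesis by (intro exI[of _ d] ballI)
  qed simp
qed

section \<open>Points and blocks of a Steiner triple system\<close>

locale steiner =
  fixes n :: nat and S :: "nat set set"
  assumes sts: "steiner_triple_system n S" and n_gt_7: "n > 7"
begin

lemma block_subset: "B \<in> S \<Longrightarrow> B \<subseteq> {1..n}"
  and block_card: "B \<in> S \<Longrightarrow> card B = 3"
  using sts by (auto simp: steiner_triple_system_def)

lemma finite_block: "B \<in> S \<Longrightarrow> finite B"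
  using block_card card.infinite by fastforce

lemma finite_blocks: "finite S"
  by (rule finite_subset[of _ "Pow {1..n}"]) (use block_subset in auto)

lemma block_through_pair:
  assumes "x \<in> {1..n}" "y \<in> {1..n}" "x \<noteq> y"
  shows "\<exists>!B. B \<in> S \<and> x \<in> B \<and> y \<in> B"
proof -
  have "{x, y} \<subseteq> {1..n} \<and> card {x, y} = 2" using assms by auto
  then have "\<exists>!B. B \<in> S \<and> {x, y} \<subseteq> B"
    using sts by (simp only: steiner_triple_system_def)
  then show ?thesis by simp
qed

lemma blocks_meet:
  assumes "B \<in> S" "C \<in> S" "x \<in> B" "x \<in> C" "y \<in> B" "y \<in> C" "x \<noteq> y"
  shows "B = C"
proof -
  have "x \<in> {1..n}" "y \<in> {1..n}" using assms block_subset[OF assms(1)] by auto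
  from block_through_pair[OF this \<open>x \<noteq> y\<close>] show ?thesis using assms by auto
qed

text \<open>Off the diagonal this is the product of the Steiner quasigroup of \<open>S\<close>; on
  the diagonal it is unspecified.\<close>

definition third :: "nat \<Rightarrow> nat \<Rightarrow> nat" where
  "third x y = (THE z. z \<noteq> x \<and> z \<noteq> y \<and> {x, y, z} \<in> S)"

lemma third_unique:
  assumes "{x, y, z} \<in> S" "{x, y, z'} \<in> S" "z \<noteq> x" "z \<noteq> y" "x \<noteq> y" "z' \<noteq> x" "z' \<noteq> y"
  shows "z = z'"
  using blocks_meet[OF assms(1,2), of x y] assms by auto

lemma third_eqI:
  assumes "{x, y, z} \<in> S" "z \<noteq> x" "z \<noteq> y" "x \<noteq> y"
  shows "third x y = z"
  unfolding third_def using assms by (intro the_equality conjI) (blast intro: third_unique)+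

lemma third:
  assumes "x \<in> {1..n}" "y \<in> {1..n}" "x \<noteq> y"
  shows "third x y \<in> {1..n}" "third x y \<noteq> x" "third x y \<noteq> y" "{x, y, third x y} \<in> S"
proof -
  obtain B where B: "B \<in> S" "x \<in> B" "y \<in> B" using block_through_pair[OF assms] by blast
  have "card (B - {x, y}) = 1"
    using B block_card[OF B(1)] assms finite_block by (subst card_Diff_subset) auto
  then obtain z where z: "B - {x, y} = {z}" using card_1_singletonE by blast
  then have Bz: "B = {x, y, z}" "z \<noteq> x" "z \<noteq> y" using B by auto
  then have "third x y = z" using third_eqI B assms by blast
  then show "third x y \<in> {1..n}" "third x y \<noteq> x" "third x y \<noteq> y" "{x, y, third x y} \<in> S"
    using Bz B block_subset[OF B(1)] by auto
qed

lemma block_eq_third: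
  assumes "B \<in> S" "x \<in> B" "y \<in> B" "x \<noteq> y"
  shows "B = {x, y, third x y}"
proof -
  have "x \<in> {1..n}" "y \<in> {1..n}" using assms block_subset[OF assms(1)] by auto
  from third[OF this assms(4)] show ?thesis using blocks_meet[of B _ x y] assms by blast
qed

lemma third_third:
  assumes "x \<in> {1..n}" "y \<in> {1..n}" "x \<noteq> y"
  shows "third x (third x y) = y"
  using third[OF assms] assms by (intro third_eqI) (auto simp: insert_commute)

section \<open>Blocks through a point\<close>

definition through :: "nat \<Rightarrow> nat set set" where
  "through p = {B \<in> S. p \<in> B}"

lemma finite_through: "finite (through p)"
  using finite_blocks by (simp add: through_def)

text \<open>Each point other than \<open>q\<close> shares exactly one block with \<open>q\<close>,
  so the punctured blocks partition the remaining points.\<close>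

lemma sum_through_punctured:
  fixes f :: "nat \<Rightarrow> real"
  assumes "q \<in> {1..n}"
  shows "(\<Sum>B\<in>through q. \<Sum>p\<in>B - {q}. f p) = (\<Sum>p\<in>{1..n} - {q}. f p)"
proof -
  have U: "{1..n} - {q} = (\<Union>B\<in>through q. B - {q})"
  proof (intro equalityI subsetI)
    fix x
    assume x: "x \<in> {1..n} - {q}"
    then obtain B where "B \<in> S" "q \<in> B" "x \<in> B"
      using block_through_pair[OF assms, of x] by blast
    then show "x \<in> (\<Union>B\<in>through q. B - {q})" using x by (auto simp: through_def)
  next
    fix x
    assume "x \<in> (\<Union>B\<in>through q. B - {q})"
    then obtain B where "B \<in> S" "x \<in> B" "x \<noteq> q" by (auto simp: through_def)
    then show "x \<in> {1..n} - {q}" using block_subset[of B] by blast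
  qed
  show ?thesis unfolding U
  proof (rule sum.UNION_disjoint[symmetric])
    show "\<forall>B\<in>through q. \<forall>C\<in>through q. B \<noteq> C \<longrightarrow> (B - {q}) \<inter> (C - {q}) = {}"
      using blocks_meet unfolding through_def by blast
  qed (use finite_through finite_block in \<open>auto simp: through_def\<close>)
qed

lemma card_punctured: "B \<in> through q \<Longrightarrow> card (B - {q}) = 2"
  using block_card finite_block by (auto simp: through_def card_Diff_singleton)

lemma card_through:
  assumes "q \<in> {1..n}"
  shows "2 * card (through q) = n - 1"
proof -
  have "real (2 * card (through q)) = (\<Sum>B\<in>through q. \<Sum>p\<in>B - {q}. 1)"
    by (simp add: card_punctured)
  also have "\<dots> = real (n - 1)"
    using assms by (subst sum_through_punctured) (auto simp: card_Diff_singleton)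
  finally show ?thesis by linarith
qed

text \<open>In matrix form \<open>N N^T = (n - 3) / 2 I + J\<close> for the point-block incidence
  matrix \<open>N\<close>: the point \<open>q\<close> is counted in each of its
  \<open>(n - 1) / 2\<close> blocks, every other point once.\<close>

lemma sum_through:
  fixes f :: "nat \<Rightarrow> real"
  assumes "q \<in> {1..n}"
  shows "(\<Sum>B\<in>through q. \<Sum>p\<in>B. f p) = (real n - 3) / 2 * f q + (\<Sum>p=1..n. f p)"
proof -
  have "(\<Sum>B\<in>through q. \<Sum>p\<in>B. f p) = (\<Sum>B\<in>through q. f q + (\<Sum>p\<in>B - {q}. f p))"
    by (intro sum.cong refl sum.remove) (auto simp: through_def finite_block)
  also have "\<dots> = real (card (through q)) * f q + (\<Sum>p\<in>{1..n} - {q}. f p)"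
    by (simp add: sum.distrib sum_through_punctured[OF assms])
  also have "(\<Sum>p\<in>{1..n} - {q}. f p) = (\<Sum>p=1..n. f p) - f q"
    using assms by (simp add: sum_diff1)
  also have "real (card (through q)) = (real n - 1) / 2"
  proof -
    have "real (2 * card (through q)) = real (n - 1)" by (simp only: card_through[OF assms])
    then show ?thesis using n_gt_7 by (simp add: of_nat_diff)
  qed
  finally show ?thesis by (simp add: field_simps)
qed

section \<open>Adjacency operator and spectrum of the block graph\<close>

lemma edge_iff:
  assumes "B \<in> S" "C \<in> S"
  shows "{B, C} \<in> edges (block_graph S) \<longleftrightarrow> B \<noteq> C \<and> B \<inter> C \<noteq> {}"
  using assms unfolding block_graph_def by (auto simp: doubleton_eq_iff)

lemma card_inter_blocks:
  assumes "B \<in> S" "C \<in> S"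
  shows "real (card (B \<inter> C)) = adj_matrix (block_graph S) B C + (if C = B then 3 else 0)"
proof (cases "B = C \<or> B \<inter> C = {}")
  case True
  then show ?thesis using assms block_card[OF assms(1)] by (auto simp: adj_matrix_def edge_iff)
next
  case False
  then obtain x where x: "x \<in> B" "x \<in> C" by blast
  then have "B \<inter> C = {x}" using blocks_meet[OF assms] False by blast
  then show ?thesis using False assms by (auto simp: adj_matrix_def edge_iff)
qed

text \<open>This is \<open>A = N^T N - 3 I\<close>: the entries of \<open>N^T N\<close> are the
  intersection sizes from \<open>card_inter_blocks\<close>.\<close>

lemma adj_sum:
  assumes "B \<in> S"
  shows "(\<Sum>C\<in>S. adj_matrix (block_graph S) B C * v C) =
    (\<Sum>p\<in>B. \<Sum>C\<in>through p. v C) - 3 * v B"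
proof -
  have "(\<Sum>p\<in>B. \<Sum>C\<in>through p. v C) = (\<Sum>p\<in>B. \<Sum>C\<in>S. if p \<in> C then v C else 0)"
    by (simp add: through_def sum.inter_filter finite_blocks)
  also have "\<dots> = (\<Sum>C\<in>S. \<Sum>p\<in>B. if p \<in> C then v C else 0)"
    by (rule sum.swap)
  also have "\<dots> = (\<Sum>C\<in>S. real (card (B \<inter> C)) * v C)"
    by (simp add: sum.inter_restrict[symmetric] finite_block[OF assms])
  also have "\<dots> = (\<Sum>C\<in>S. adj_matrix (block_graph S) B C * v C + (if C = B then 3 * v C else 0))"
    by (intro sum.cong refl) (simp add: card_inter_blocks[OF assms] algebra_simps)
  also have "\<dots> = (\<Sum>C\<in>S. adj_matrix (block_graph S) B C * v C) + 3 * v B"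
    using assms finite_blocks by (simp add: sum.distrib)
  finally show ?thesis by simp
qed

text \<open>Combines \<open>A = N^T N - 3 I\<close> with the formula for \<open>N N^T\<close>,
  applied to the vector \<open>N^T w\<close>. Weights of total 0 or constant weights make it an
  eigenvector equation.\<close>

lemma adj_block_sum:
  assumes "B \<in> S"
  shows "(\<Sum>C\<in>S. adj_matrix (block_graph S) B C * (\<Sum>p\<in>C. w p)) =
    (real n - 9) / 2 * (\<Sum>p\<in>B. w p) + 3 * (\<Sum>p=1..n. w p)"
proof -
  have "(\<Sum>p\<in>B. \<Sum>C\<in>through p. \<Sum>p\<in>C. w p) =
      (\<Sum>p\<in>B. (real n - 3) / 2 * w p + (\<Sum>p=1..n. w p))"
    using block_subset[OF assms] by (intro sum.cong refl sum_through) auto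
  also have "\<dots> = (real n - 3) / 2 * (\<Sum>p\<in>B. w p) + 3 * (\<Sum>p=1..n. w p)"
    by (simp add: sum.distrib sum_distrib_left block_card[OF assms])
  finally show ?thesis by (subst adj_sum[OF assms]) (simp add: field_simps)
qed

lemma verts_block_graph: "verts (block_graph S) = S"
  by (simp add: block_graph_def)

lemma blocks_nonempty: "S \<noteq> {}"
  using block_through_pair[of 1 2] n_gt_7 by auto

text \<open>The vector \<open>w = N v\<close> of sums through points satisfies
  \<open>(\<theta> + 3) v = N^T w\<close>, hence \<open>N N^T w = (\<theta> + 3) w\<close>. If
  \<open>\<theta>\<close> avoids all three values, first the total of \<open>w\<close>, then
  \<open>w\<close>, then \<open>v\<close> vanishes.\<close>

lemma eigenvalue_cases:
  assumes "is_eigenvector (block_graph S) \<theta> v"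
  shows "\<theta> = (3 * real n - 9) / 2 \<or> \<theta> = (real n - 9) / 2 \<or> \<theta> = -3"
proof (rule ccontr)
  assume "\<not> ?thesis"
  then have ne: "\<theta> \<noteq> (3 * real n - 9) / 2" "\<theta> \<noteq> (real n - 9) / 2" "\<theta> + 3 \<noteq> 0" by auto
  define w where "w p = (\<Sum>B\<in>through p. v B)" for p
  define W where "W = (\<Sum>p=1..n. w p)"
  have v: "(\<theta> + 3) * v B = (\<Sum>p\<in>B. w p)" if "B \<in> S" for B
    using assms that adj_sum[OF that, of v]
    by (simp add: is_eigenvector_def verts_block_graph w_def algebra_simps)
  have w: "(\<theta> - (real n - 9) / 2) * w q = W" if "q \<in> {1..n}" for q
  proof -
    have "(\<theta> + 3) * w q = (\<Sum>B\<in>through q. (\<theta> + 3) * v B)"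
      by (simp add: w_def sum_distrib_left)
    also have "\<dots> = (\<Sum>B\<in>through q. \<Sum>p\<in>B. w p)"
      by (intro sum.cong refl v) (simp add: through_def)
    also have "\<dots> = (real n - 3) / 2 * w q + W"
      by (simp add: sum_through[OF that] W_def)
    finally show ?thesis by (simp add: field_simps)
  qed
  \<comment> \<open>Summing over all points gives \<open>n * W\<close> on the right, and
    \<open>(n - 9) / 2 + n = (3 * n - 9) / 2\<close>.\<close>
  have "(\<theta> - (real n - 9) / 2) * W = (\<Sum>q=1..n. (\<theta> - (real n - 9) / 2) * w q)"
    unfolding W_def by (rule sum_distrib_left)
  also have "\<dots> = (\<Sum>q=1..n. W)" by (intro sum.cong refl w)
  finally have "(\<theta> - (3 * real n - 9) / 2) * W = 0" by (simp add: field_simps)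
  then have "W = 0" using ne(1) by simp
  then have "w q = 0" if "q \<in> {1..n}" for q using w[OF that] ne(2) by simp
  then have "v B = 0" if "B \<in> S" for B
    using v[OF that] ne(3) block_subset[OF that] by (simp add: subset_iff sum.neutral)
  then show False using assms by (auto simp: is_eigenvector_def verts_block_graph)
qed

lemma theta_1:
  assumes "is_eigenvector (block_graph S) ((real n - 9) / 2) u"
  shows "theta 1 (block_graph S) = (real n - 9) / 2"
proof -
  let ?E = "eigenvalues (block_graph S)"
  define a b where "a = (3 * real n - 9) / 2" and b_def: "b = (real n - 9) / 2"
  have less: "-3 < b" "b < a" using n_gt_7 by (auto simp: a_def b_def)
  \<comment> \<open>Weights \<open>1 / 3\<close> represent the all-ones vector as block sums;
    \<open>a\<close> is the valency.\<close>
  have "is_eigenvector (block_graph S) a (\<lambda>B. \<Sum>p\<in>B. 1 / 3)"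
    using blocks_nonempty
    by (auto simp: is_eigenvector_def verts_block_graph adj_block_sum a_def simp del: sum_constant)
       (auto simp: block_card field_simps)
  then have "a \<in> ?E" by (auto simp: eigenvalues_def)
  moreover have "b \<in> ?E" using assms by (auto simp: eigenvalues_def b_def)
  moreover have "?E \<subseteq> {a, b, -3}"
    using eigenvalue_cases unfolding eigenvalues_def a_def b_def by blast
  \<comment> \<open>Index 1 selects the second largest eigenvalue, which is \<open>b\<close> in both
    sets.\<close>
  ultimately have "?E = {b, a} \<or> ?E = {-3, b, a}" by blast
  moreover have "sorted_list_of_set {b, a} = [b, a]"
    using sorted_list_of_set.idem_if_sorted_distinct[of "[b, a]"] less by simp
  moreover have "sorted_list_of_set {-3, b, a} = [-3, b, a]"
    using sorted_list_of_set.idem_if_sorted_distinct[of "[-3, b, a]"] less by simp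
  ultimately have "theta 1 (block_graph S) = b" by (auto simp: theta_def)
  then show ?thesis by (simp add: b_def)
qed

section \<open>From point weights to bounds on \<open>m\<close>\<close>

text \<open>The block sums are an eigenvector for \<open>(n - 9) / 2\<close> by
  \<open>adj_block_sum\<close>. Its existence lets \<open>theta_1\<close> identify this value as the
  eigenvalue of index 1.\<close>

lemma m_1_le:
  fixes w :: "nat \<Rightarrow> int" and k :: nat
  assumes "(\<Sum>p=1..n. w p) = 0"
    and "\<And>B. B \<in> S \<Longrightarrow> (\<Sum>p\<in>B. w p) \<noteq> 0 \<and> \<bar>\<Sum>p\<in>B. w p\<bar> \<le> int k"
  shows "m 1 (block_graph S) \<le> ereal (real k + 1)"
proof -
  define u where "u B = (\<Sum>p\<in>B. real_of_int (w p))" for B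
  have u: "u B = real_of_int (\<Sum>p\<in>B. w p)" for B by (simp add: u_def)
  have W: "(\<Sum>p=1..n. real_of_int (w p)) = 0" using assms(1) by (metis of_int_0 of_int_sum)
  have nz: "u B \<noteq> 0" if "B \<in> S" for B using assms(2)[OF that] unfolding u of_int_eq_0_iff by blast
  have eig: "is_eigenvector (block_graph S) ((real n - 9) / 2) u"
    using blocks_nonempty nz adj_block_sum[of _ "\<lambda>p. real_of_int (w p)"]
    unfolding is_eigenvector_def verts_block_graph W u_def by auto
  have "nowhere_zero_integer (block_graph S) u"
    using nz by (auto simp: nowhere_zero_integer_def verts_block_graph u)
  moreover have "is_eigenvector (block_graph S) (theta 1 (block_graph S)) u"
    unfolding theta_1[OF eig] by (fact eig)
  moreover have "\<bar>u B\<bar> \<le> real k" if "B \<in> S" for B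
    using assms(2)[OF that] unfolding u by linarith
  then have "sup_norm (block_graph S) u \<le> real k"
    using blocks_nonempty finite_blocks by (auto simp: sup_norm_def verts_block_graph)
  ultimately show ?thesis
    unfolding m_def by (intro INF_lower2[of u]) auto
qed

text \<open>A sum of three odd numbers is odd. This handles the blocks avoiding the points of
  exceptional weight.\<close>

lemma odd_sum_bound:
  fixes w :: "nat \<Rightarrow> int"
  assumes "B \<in> S" and "\<And>p. p \<in> B \<Longrightarrow> w p = 1 \<or> w p = -1"
  shows "(\<Sum>p\<in>B. w p) \<noteq> 0 \<and> \<bar>\<Sum>p\<in>B. w p\<bar> \<le> 3"
proof -
  obtain x y z where "B = {x, y, z}" "x \<noteq> y" "y \<noteq> z" "x \<noteq> z"
    using block_card[OF assms(1)] by (auto simp: card_3_iff)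
  then show ?thesis using assms(2)[of x] assms(2)[of y] assms(2)[of z] by auto
qed

section \<open>Weights for \<open>n mod 4 = 1\<close>\<close>

lemma m_1_le_4:
  assumes "n mod 4 = 1"
  shows "m 1 (block_graph S) \<le> 4"
proof -
  have p: "1 \<in> {1..n}" using n_gt_7 by simp
  \<comment> \<open>There are \<open>(n - 1) / 2\<close> blocks through the point 1, so exactly half
    of them can be put into \<open>R\<close>.\<close>
  have "even (card (through 1))" using card_through[OF p] assms n_gt_7 by presburger
  then obtain k where k: "card (through 1) = 2 * k" by blast
  then obtain R where R: "R \<subseteq> through 1" "card R = k" "finite R"
    using obtain_subset_with_card_n[of k "through 1"] by auto
  define w :: "nat \<Rightarrow> int" where
    "w x = (if x = 1 then 0 else if x \<in> \<Union>R then 1 else -1)" for x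
  \<comment> \<open>Blocks through 1 share no further point, so the sign of \<open>x\<close> is
    decided by the one block joining it to 1.\<close>
  have wB: "w x = (if B \<in> R then 1 else -1)" if "B \<in> through 1" "x \<in> B - {1}" for B x
  proof -
    have "x \<in> \<Union>R \<longleftrightarrow> B \<in> R"
      using that R(1) blocks_meet[of B _ 1 x] unfolding through_def by blast
    then show ?thesis using that by (simp add: w_def)
  qed
  have s: "(\<Sum>x\<in>B - {1}. w x) = (if B \<in> R then 2 else -2)" if "B \<in> through 1" for B
  proof -
    have "(\<Sum>x\<in>B - {1}. w x) = (\<Sum>x\<in>B - {1}. if B \<in> R then 1 else -1)"
      using wB[OF that] by (intro sum.cong) auto
    then show ?thesis by (simp add: card_punctured[OF that, simplified])
  qed
  \<comment> \<open>Grouped by blocks through 1, the total has equally many contributions 2 and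
    -2.\<close>
  have "(\<Sum>x=1..n. real_of_int (w x)) = (\<Sum>x\<in>{1..n} - {1}. real_of_int (w x))"
    using p by (subst sum.remove[of _ 1]) (auto simp: w_def)
  also have "\<dots> = (\<Sum>B\<in>through 1. real_of_int (\<Sum>x\<in>B - {1}. w x))"
    by (simp only: sum_through_punctured[OF p] of_int_sum)
  also have "\<dots> = (\<Sum>B\<in>through 1. if B \<in> R then 2 else -2)"
    by (intro sum.cong refl, subst s) simp_all
  also have "\<dots> = 2 * real (card R) - 2 * real (card (through 1 - R))"
    by (subst sum.subset_diff[OF R(1) finite_through]) simp
  also have "\<dots> = 0" using R k by (simp add: card_Diff_subset)
  finally have W: "(\<Sum>x=1..n. w x) = 0" by (metis of_int_eq_0_iff of_int_sum)
  have "(\<Sum>x\<in>B. w x) \<noteq> 0 \<and> \<bar>\<Sum>x\<in>B. w x\<bar> \<le> int 3" if B: "B \<in> S" for B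
  proof (cases "1 \<in> B")
    case True
    then have "(\<Sum>x\<in>B. w x) = (\<Sum>x\<in>B - {1}. w x)"
      using finite_block[OF B] by (subst sum.remove[of _ 1]) (auto simp: w_def)
    also have "\<dots> = (if B \<in> R then 2 else -2)"
      using True B by (intro s) (simp add: through_def)
    finally show ?thesis by simp
  next
    case False
    then have "(\<Sum>x\<in>B. w x) \<noteq> 0 \<and> \<bar>\<Sum>x\<in>B. w x\<bar> \<le> 3"
      by (intro odd_sum_bound[OF B]) (auto simp: w_def)
    then show ?thesis by simp
  qed
  from m_1_le[OF W this] show ?thesis by simp
qed

section \<open>Weights from a 2-colouring off one block\<close>

lemma m_1_le_5: "m 1 (block_graph S) \<le> 5"
proof -
  define r where "r = third 1 2"
  have pq: "1 \<in> {1..n}" "2 \<in> {1..n}" "(1::nat) \<noteq> 2" using n_gt_7 by auto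
  have r: "r \<in> {1..n}" "r \<noteq> 1" "r \<noteq> 2" "{1, 2, r} \<in> S"
    using third[OF pq] by (auto simp: r_def)
  define X where "X = {1..n} - {1, 2, r}"
  have finX: "finite X" by (simp add: X_def)
  \<comment> \<open>A block through \<open>p\<close> and \<open>x\<close> with another point of
    \<open>{1, 2, r}\<close> would equal that block and so contain no \<open>x\<close> from
    \<open>X\<close>.\<close>
  have matching: "third p x \<in> X \<and> third p x \<noteq> x \<and> third p (third p x) = x"
    if p: "p = 1 \<or> p = 2" and x: "x \<in> X" for p x
  proof -
    have x': "x \<in> {1..n}" "p \<noteq> x" and p': "p \<in> {1..n}" using x p pq by (auto simp: X_def)
    note t = third[OF p' x'] and tt = third_third[OF p' x']
    have "third p x \<notin> {1, 2, r}"
    proof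
      assume "third p x \<in> {1, 2, r}"
      then have "{p, x, third p x} = {1, 2, r}"
        using blocks_meet[OF t(4) r(4), of p "third p x"] t p by auto
      then show False using x by (auto simp: X_def)
    qed
    then show ?thesis using t tt by (auto simp: X_def)
  qed
  have "\<exists>c :: nat \<Rightarrow> bool. \<forall>x\<in>X. c (third 1 x) \<noteq> c x \<and> c (third 2 x) \<noteq> c x"
    using finX by (rule two_matchings_colouring) (use matching in auto)
  then obtain c :: "nat \<Rightarrow> bool" where
    c: "\<And>x. x \<in> X \<Longrightarrow> c (third 1 x) \<noteq> c x \<and> c (third 2 x) \<noteq> c x" by blast
  have "card X = n - 3" using r pq unfolding X_def by (subst card_Diff_subset) auto
  then have "X \<noteq> {}" using n_gt_7 by auto
  \<comment> \<open>Matched points have different colours, so both colours occur.\<close>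
  then obtain x0 where x0: "x0 \<in> X" "\<not> c x0" using c matching by blast
  define s :: "nat \<Rightarrow> int" where "s x = (if c x then 1 else -1)" for x
  \<comment> \<open>The weights 2, -3, -1 total -2, which the raised weight at \<open>x0\<close>
    offsets. With pair sums 0 or 2 on \<open>X\<close>, the other blocks through 1 get 2 or 4, those
    through 2 get -3 or -1, and \<open>{1, 2, r}\<close> gets -2.\<close>
  define w :: "nat \<Rightarrow> int" where
    "w x = (if x = 1 then 2 else if x = 2 then -3 else if x = r then -1
      else s x + (if x = x0 then 2 else 0))" for x
  have w_vals: "w 1 = 2" "w 2 = -3" "w r = -1" using r by (auto simp: w_def)
  have wX: "w x = s x + (if x = x0 then 2 else 0)" if "x \<in> X" for x
    using that by (auto simp: w_def X_def)
  have w_unit: "w x = 1 \<or> w x = -1" if "x \<noteq> 1" "x \<noteq> 2" for x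
    using that x0 by (auto simp: w_def s_def)
  \<comment> \<open>The involution \<open>third 1\<close> reverses the sign of \<open>s\<close>, so
    the sum equals its own negative.\<close>
  have "(\<Sum>x\<in>X. s x) = (\<Sum>x\<in>X. s (third 1 x))"
    by (rule sum.reindex_bij_witness[of _ "third 1" "third 1"]) (use matching in auto)
  also have "\<dots> = (\<Sum>x\<in>X. - s x)"
    using c by (intro sum.cong refl) (auto simp: s_def)
  finally have "(\<Sum>x\<in>X. s x) = 0" by (simp add: sum_negf)
  then have WX: "(\<Sum>x\<in>X. w x) = 2"
    using wX x0 finX by (simp add: sum.distrib)
  have notin_X: "1 \<notin> X" "2 \<notin> X" "r \<notin> X" by (auto simp: X_def)
  have U: "{1..n} = insert 1 (insert 2 (insert r X))" using r pq by (auto simp: X_def)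
  have W: "(\<Sum>x=1..n. w x) = 0"
    unfolding U using r WX w_vals finX notin_X by simp
  \<comment> \<open>Opposite signs cancel, except that the pair containing \<open>x0\<close> now has
    both weights equal to 1.\<close>
  have pair: "w x + w (third p x) \<in> {0, 2}" if "p = 1 \<or> p = 2" "x \<in> X" for p x
    using that c[OF that(2)] matching[OF that] wX x0 by (auto simp: s_def)
  have block: "\<exists>x\<in>X. B = {p, x, third p x}"
    if B: "B \<in> S" "B \<noteq> {1, 2, r}" and p: "p \<in> B" "p = 1 \<or> p = 2" for B p
  proof -
    have "B \<noteq> {p}" using block_card[OF B(1)] by auto
    then obtain x where x: "x \<in> B" "x \<noteq> p" using p by blast
    have "x \<notin> {1, 2, r}" using blocks_meet[OF B(1) r(4), of p x] x p B by auto
    then have "x \<in> X" using x block_subset[OF B(1)] by (auto simp: X_def)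
    then show ?thesis using block_eq_third[OF B(1) p(1) x(1)] x by blast
  qed
  have pair_sum: "(\<Sum>x\<in>B. w x) \<in> {w p, w p + 2}"
    if B: "B \<in> S" "B \<noteq> {1, 2, r}" and p: "p \<in> B" "p = 1 \<or> p = 2" for B p
  proof -
    obtain x where x: "x \<in> X" "B = {p, x, third p x}" using block[OF B p] by blast
    have "p \<notin> X" using p by (auto simp: X_def)
    then have "p \<noteq> x" "p \<noteq> third p x" using x matching[OF p(2) x(1)] by auto
    then have "(\<Sum>x\<in>B. w x) = w p + (w x + w (third p x))"
      using matching[OF p(2) x(1)] x by auto
    then show ?thesis using pair[OF p(2) x(1)] by auto
  qed
  have "(\<Sum>x\<in>B. w x) \<noteq> 0 \<and> \<bar>\<Sum>x\<in>B. w x\<bar> \<le> int 4" if B: "B \<in> S" for B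
  proof -
    consider "B = {1, 2, r}" | "B \<noteq> {1, 2, r}" "1 \<in> B" | "B \<noteq> {1, 2, r}" "2 \<in> B"
      | "1 \<notin> B" "2 \<notin> B" by blast
    then show ?thesis
    proof cases
      case 1
      then show ?thesis using r w_vals by auto
    next
      case 2
      then show ?thesis using pair_sum[OF B, of 1] w_vals by auto
    next
      case 3
      then show ?thesis using pair_sum[OF B, of 2] w_vals by auto
    next
      case 4
      then have "(\<Sum>x\<in>B. w x) \<noteq> 0 \<and> \<bar>\<Sum>x\<in>B. w x\<bar> \<le> 3"
        by (intro odd_sum_bound[OF B] w_unit) auto
      then show ?thesis by linarith
    qed
  qed
  from m_1_le[OF W this] show ?thesis by simp
qed

end

theorem theorem6:
  fixes n :: nat and S :: "nat set set"
  assumes "steiner_triple_system n S"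
    and "n > 7"
  shows "(n mod 4 = 1 \<longrightarrow> m 1 (block_graph S) \<le> 4) \<and>
         (n mod 4 = 3 \<longrightarrow> m 1 (block_graph S) \<le> 5)"
proof -
  interpret steiner n S using assms by unfold_locales
  show ?thesis using m_1_le_4 m_1_le_5 by blast
qed

end
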